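(* Let $L$ be a normal monomodal logic (in the language with the single diamond $\Diamond$) that extends $K5_2$, where $K5_2$ is the smallest normal modal logic containing the axiom $\Diamond\Diamond p\to\Box\Diamond p$. If $L$ is $\omega$-canonical, then $L$ is totally canonical.
   Context: Monomodal formulas are built from countably many atoms $q_0,q_1,\dots$ using $\top,\neg,\vee,\Diamond$, with $\Box\varphi=\neg\Diamond\neg\varphi$. A normal modal logic is a set of formulas containing all propositional tautologies, $\Box(p\to q)\to(\Box p\to\Box q)$ and $\Diamond p\leftrightarrow\neg\Box\neg p$, and closed under modus ponens, generalisation (from $\varphi$ infer $\Box\varphi$) and uniform substitution. A $\{\Diamond\}$-BAO is a boolean algebra $\mathcal A$ with an operation $\Diamond$ satisfying $\Diamond 0=0$ and $\Diamond(a+b)=\Diamond a+\Diamond b$. Formulas translate to algebra terms in the usual way (atoms become variables); $V_L$ denotes the variety of all $\{\Diamond\}$-BAOs in which the term translating each $\varphi\in L$ is identically $1$. The canonical frame $\mathcal A_+$ has the ultrafilters of $\mathcal A$ as points, with $R_\Diamond\mu\nu$ iff $\Diamond a\in\mu$ for every $a\in\nu$. The canonical extension $\mathcal A^\sigma$ is the algebra of all subsets of $\mathcal A_+$ with $\Diamond X=\{\mu:\exists\nu\in X\ R_\Diamond\mu\nu\}$. For a cardinal $\kappa$, $L$ is $\kappa$-canonical if $\mathcal A^\sigma\in V_L$ for every $\mathcal A\in V_L$ that is generated as an algebra by a subset of cardinality at most $\kappa$ (equivalently, every canonical frame of $L$ defined using at most $\kappa$ atoms validates $L$). $L$ is totally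 canonical if $\mathcal A^\sigma\in V_L$ for every $\mathcal A\in V_L$. *)

theory Defs
  imports Main
begin

unbundle cardinal_syntax

section \<open>Monomodal formulas and normal modal logics\<close>

datatype fm = Atom nat | Top | Neg fm | Or fm fm | Dia fm

definition And :: "fm \<Rightarrow> fm \<Rightarrow> fm" where
  "And \<phi> \<psi> = Neg (Or (Neg \<phi>) (Neg \<psi>))"

definition Imp :: "fm \<Rightarrow> fm \<Rightarrow> fm" where
  "Imp \<phi> \<psi> = Or (Neg \<phi>) \<psi>"

definition Iff :: "fm \<Rightarrow> fm \<Rightarrow> fm" where
  "Iff \<phi> \<psi> = And (Imp \<phi> \<psi>) (Imp \<psi> \<phi>)"

definition Box :: "fm \<Rightarrow> fm" where
  "Box \<phi> = Neg (Dia (Neg \<phi>))"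

primrec subst :: "(nat \<Rightarrow> fm) \<Rightarrow> fm \<Rightarrow> fm" where
  "subst \<sigma> (Atom n) = \<sigma> n"
| "subst \<sigma> Top = Top"
| "subst \<sigma> (Neg \<phi>) = Neg (subst \<sigma> \<phi>)"
| "subst \<sigma> (Or \<phi> \<psi>) = Or (subst \<sigma> \<phi>) (subst \<sigma> \<psi>)"
| "subst \<sigma> (Dia \<phi>) = Dia (subst \<sigma> \<phi>)"

text \<open>
  Formulas \<open>Dia \<phi>\<close> are treated as further propositional letters, so the tautologies below
  are the substitution instances of the diamond-free ones. As normal logics are closed under
  uniform substitution, requiring only the diamond-free ones would give the same notion of
  normal logic.
\<close>

primrec prop_true :: "(fm \<Rightarrow> bool) \<Rightarrow> fm \<Rightarrow> bool" where
  "prop_true h (Atom n) \<longleftrightarrow> h (Atom n)"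
| "prop_true h Top \<longleftrightarrow> True"
| "prop_true h (Neg \<phi>) \<longleftrightarrow> \<not> prop_true h \<phi>"
| "prop_true h (Or \<phi> \<psi>) \<longleftrightarrow> prop_true h \<phi> \<or> prop_true h \<psi>"
| "prop_true h (Dia \<phi>) \<longleftrightarrow> h (Dia \<phi>)"

definition tautology :: "fm \<Rightarrow> bool" where
  "tautology \<phi> \<longleftrightarrow> (\<forall>h. prop_true h \<phi>)"

definition normal_logic :: "fm set \<Rightarrow> bool" where
  "normal_logic L \<longleftrightarrow>
     (\<forall>\<phi>. tautology \<phi> \<longrightarrow> \<phi> \<in> L) \<and>
     Imp (Box (Imp (Atom 0) (Atom 1))) (Imp (Box (Atom 0)) (Box (Atom 1))) \<in> L \<and>
     Iff (Dia (Atom 0)) (Neg (Box (Neg (Atom 0)))) \<in> L \<and>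
     (\<forall>\<phi> \<psi>. \<phi> \<in> L \<and> Imp \<phi> \<psi> \<in> L \<longrightarrow> \<psi> \<in> L) \<and>
     (\<forall>\<phi>. \<phi> \<in> L \<longrightarrow> Box \<phi> \<in> L) \<and>
     (\<forall>\<phi> \<sigma>. \<phi> \<in> L \<longrightarrow> subst \<sigma> \<phi> \<in> L)"

definition K5_2 :: "fm set" where
  "K5_2 = \<Inter> {L. normal_logic L \<and> Imp (Dia (Dia (Atom 0))) (Box (Dia (Atom 0))) \<in> L}"


section \<open>Boolean algebras with one operator\<close>

text \<open>
  Algebras have explicit carriers, since the notions of canonicity quantify over all algebras,
  including finite ones. The operations are irrelevant outside the carrier.
\<close>

record 'a bao =
  carrier :: "'a set"
  zero :: 'a
  one :: 'a
  join :: "'a \<Rightarrow> 'a \<Rightarrow> 'a"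
  meet :: "'a \<Rightarrow> 'a \<Rightarrow> 'a"
  compl :: "'a \<Rightarrow> 'a"
  dia :: "'a \<Rightarrow> 'a"

text \<open>
  The boolean axioms are those of the library locale \<^locale>\<open>abstract_boolean_algebra\<close>,
  relativised to the carrier. The one-element algebra is allowed.
\<close>

locale BAO =
  fixes A :: "'a bao"
  assumes zero_closed: "zero A \<in> carrier A"
    and one_closed: "one A \<in> carrier A"
    and join_closed: "\<lbrakk>a \<in> carrier A; b \<in> carrier A\<rbrakk> \<Longrightarrow> join A a b \<in> carrier A"
    and meet_closed: "\<lbrakk>a \<in> carrier A; b \<in> carrier A\<rbrakk> \<Longrightarrow> meet A a b \<in> carrier A"
    and compl_closed: "a \<in> carrier A \<Longrightarrow> compl A a \<in> carrier A"
    and dia_closed: "a \<in> carrier A \<Longrightarrow> dia A a \<in> carrier A"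
    and join_assoc: "\<lbrakk>a \<in> carrier A; b \<in> carrier A; c \<in> carrier A\<rbrakk> \<Longrightarrow>
      join A (join A a b) c = join A a (join A b c)"
    and meet_assoc: "\<lbrakk>a \<in> carrier A; b \<in> carrier A; c \<in> carrier A\<rbrakk> \<Longrightarrow>
      meet A (meet A a b) c = meet A a (meet A b c)"
    and join_comm: "\<lbrakk>a \<in> carrier A; b \<in> carrier A\<rbrakk> \<Longrightarrow> join A a b = join A b a"
    and meet_comm: "\<lbrakk>a \<in> carrier A; b \<in> carrier A\<rbrakk> \<Longrightarrow> meet A a b = meet A b a"
    and meet_join_distrib: "\<lbrakk>a \<in> carrier A; b \<in> carrier A; c \<in> carrier A\<rbrakk> \<Longrightarrow>
      meet A a (join A b c) = join A (meet A a b) (meet A a c)"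
    and join_meet_distrib: "\<lbrakk>a \<in> carrier A; b \<in> carrier A; c \<in> carrier A\<rbrakk> \<Longrightarrow>
      join A a (meet A b c) = meet A (join A a b) (join A a c)"
    and meet_one: "a \<in> carrier A \<Longrightarrow> meet A a (one A) = a"
    and join_zero: "a \<in> carrier A \<Longrightarrow> join A a (zero A) = a"
    and meet_compl: "a \<in> carrier A \<Longrightarrow> meet A a (compl A a) = zero A"
    and join_compl: "a \<in> carrier A \<Longrightarrow> join A a (compl A a) = one A"
    and dia_zero: "dia A (zero A) = zero A"
    and dia_join: "\<lbrakk>a \<in> carrier A; b \<in> carrier A\<rbrakk> \<Longrightarrow>
      dia A (join A a b) = join A (dia A a) (dia A b)"

primrec term_val :: "'a bao \<Rightarrow> (nat \<Rightarrow> 'a) \<Rightarrow> fm \<Rightarrow> 'a" where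
  "term_val A v (Atom n) = v n"
| "term_val A v Top = one A"
| "term_val A v (Neg \<phi>) = compl A (term_val A v \<phi>)"
| "term_val A v (Or \<phi> \<psi>) = join A (term_val A v \<phi>) (term_val A v \<psi>)"
| "term_val A v (Dia \<phi>) = dia A (term_val A v \<phi>)"

definition in_variety :: "fm set \<Rightarrow> 'a bao \<Rightarrow> bool" where
  "in_variety L A \<longleftrightarrow>
     BAO A \<and> (\<forall>\<phi>\<in>L. \<forall>v. range v \<subseteq> carrier A \<longrightarrow> term_val A v \<phi> = one A)"

inductive_set generated :: "'a bao \<Rightarrow> 'a set \<Rightarrow> 'a set"
  for A :: "'a bao" and X :: "'a set" where
  "x \<in> X \<Longrightarrow> x \<in> generated A X"
| "zero A \<in> generated A X"
| "one A \<in> generated A X"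
| "\<lbrakk>a \<in> generated A X; b \<in> generated A X\<rbrakk> \<Longrightarrow> join A a b \<in> generated A X"
| "\<lbrakk>a \<in> generated A X; b \<in> generated A X\<rbrakk> \<Longrightarrow> meet A a b \<in> generated A X"
| "a \<in> generated A X \<Longrightarrow> compl A a \<in> generated A X"
| "a \<in> generated A X \<Longrightarrow> dia A a \<in> generated A X"


section \<open>Canonical frames and canonical extensions\<close>

text \<open>In the upward closure clause, \<open>meet A a b = a\<close> expresses that \<open>a\<close> is below \<open>b\<close>.\<close>

definition ultrafilter :: "'a bao \<Rightarrow> 'a set \<Rightarrow> bool" where
  "ultrafilter A U \<longleftrightarrow>
     U \<subseteq> carrier A \<and> one A \<in> U \<and> zero A \<notin> U \<and>
     (\<forall>a\<in>U. \<forall>b\<in>U. meet A a b \<in> U) \<and>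
     (\<forall>a\<in>U. \<forall>b\<in>carrier A. meet A a b = a \<longrightarrow> b \<in> U) \<and>
     (\<forall>a\<in>carrier A. a \<in> U \<or> compl A a \<in> U)"

definition canonical_points :: "'a bao \<Rightarrow> 'a set set" where
  "canonical_points A = {U. ultrafilter A U}"

definition canonical_rel :: "'a bao \<Rightarrow> 'a set \<Rightarrow> 'a set \<Rightarrow> bool" where
  "canonical_rel A \<mu> \<nu> \<longleftrightarrow> (\<forall>a\<in>\<nu>. dia A a \<in> \<mu>)"

definition complex_algebra :: "'w set \<Rightarrow> ('w \<Rightarrow> 'w \<Rightarrow> bool) \<Rightarrow> 'w set bao" where
  "complex_algebra W R =
     \<lparr>carrier = Pow W, zero = {}, one = W,
      join = (\<union>), meet = (\<inter>), compl = (\<lambda>X. W - X),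
      dia = (\<lambda>X. {\<mu>\<in>W. \<exists>\<nu>\<in>X. R \<mu> \<nu>})\<rparr>"

definition canonical_extension :: "'a bao \<Rightarrow> 'a set set bao" where
  "canonical_extension A = complex_algebra (canonical_points A) (canonical_rel A)"


section \<open>Canonicity\<close>

text \<open>
  Quantification over all algebras is rendered by quantification over all algebras whose carrier
  is a subset of an arbitrary type \<open>'a\<close>. An algebra generated by at most \<open>\<kappa>\<close> elements has at most
  \<open>max \<kappa> \<omega>\<close> elements, so as soon as \<open>'a\<close> has at least that many elements, \<open>'a\<close> contains an
  isomorphic copy of every such algebra and \<open>kappa_canonical TYPE('a) \<kappa> L\<close> is the unrestricted
  notion. In particular this holds for \<open>\<kappa> = natLeq\<close> (that is, \<open>\<omega>\<close>) and any infinite \<open>'a\<close>.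
  Total canonicity is \<open>totally_canonical TYPE('a) L\<close> for every type \<open>'a\<close>.
\<close>

definition kappa_canonical :: "'a itself \<Rightarrow> 'k rel \<Rightarrow> fm set \<Rightarrow> bool" where
  "kappa_canonical (_ :: 'a itself) \<kappa> L \<longleftrightarrow>
     (\<forall>A :: 'a bao. in_variety L A \<and>
        (\<exists>X \<subseteq> carrier A. |X| \<le>o \<kappa> \<and> generated A X = carrier A) \<longrightarrow>
        in_variety L (canonical_extension A))"

definition totally_canonical :: "'a itself \<Rightarrow> fm set \<Rightarrow> bool" where
  "totally_canonical (_ :: 'a itself) L \<longleftrightarrow>
     (\<forall>A :: 'a bao. in_variety L A \<longrightarrow> in_variety L (canonical_extension A))"

end

theory Submission
  imports Defs "HOL-Library.Countable_Set_Type"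
begin

text \<open>
  Suppose that \<open>A\<close> lies in the variety of \<open>L\<close> and that a formula fails, under some valuation into
  sets of points, at a point \<open>\<mu>\<close> of the canonical frame of \<open>A\<close>. It is enough to find a countably
  generated algebra \<open>B\<close> in the variety whose canonical frame refutes the same formula.

  The axiom \<open>\<Diamond>\<Diamond>p \<rightarrow> \<box>\<Diamond>p\<close> makes the subframe generated by \<open>\<mu>\<close> a sequence of levels: there
  are sets \<open>S\<^sub>0 = {\<mu>}, S\<^sub>1, S\<^sub>2, \<dots>\<close> of points, possibly overlapping, such that every point of
  \<open>S\<^sub>i\<close> sees exactly the points of \<open>S\<^sub>i\<^sub>+\<^sub>1\<close>. Moreover \<open>S\<^sub>i\<close> is closed: it consists of the
  ultrafilters that extend the filter \<open>{a. \<box>\<dots>\<box>a \<in> \<mu>}\<close> with \<open>i\<close> boxes (\<open>level_successors\<close>).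
  Truth in such a frame depends only on which points occur in each level, so in each level one
  representative of each satisfiable formula suffices. This gives a countable family of closed
  sets, namely the levels and the singletons of the representatives.

  By compactness, when finitely many members of the family have empty intersection, finitely many
  elements of \<open>A\<close> witness this (\<open>countable_separators\<close>). Let \<open>B\<close> be the subalgebra generated by
  these countably many witnesses. A point \<open>p\<close> of the canonical frame of \<open>B\<close> may be a trace
  of members of several sets in the family. The witnesses ensure that these sets have a common point
  \<open>g p\<close>. Thus \<open>g\<close> maps each level of \<open>B\<close> into the corresponding level of \<open>A\<close>
  and sends the trace of a representative to that representative. Pulling the valuation back along
  \<open>g\<close> therefore preserves the truth of all formulas (\<open>truth_transfer\<close>), and the trace of \<open>\<mu>\<close>
  refutes the formula, contrary to \<open>\<omega>\<close>-canonicity.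
\<close>

text \<open>
  Countability of the set of formulas bounds both the number of representatives and the size of
  an algebra with countably many generators.
\<close>

instance fm :: countable
  by countable_datatype


section \<open>Boolean algebra relative to a carrier\<close>

context BAO
begin

lemmas closed = zero_closed one_closed join_closed meet_closed compl_closed dia_closed

lemma meet_zero: "a \<in> carrier A \<Longrightarrow> meet A a (zero A) = zero A"
  by (metis closed(1,5) join_comm join_zero meet_closed meet_compl meet_join_distrib)

lemma meet_idem: "a \<in> carrier A \<Longrightarrow> meet A a a = a"
  by (metis compl_closed join_compl join_zero meet_closed meet_compl meet_join_distrib meet_one)

lemma join_one: "a \<in> carrier A \<Longrightarrow> join A a (one A) = one A"
  by (metis closed(2,5) join_closed join_compl join_meet_distrib meet_comm meet_one)

lemma compl_unique:
  assumes "a \<in> carrier A" "b \<in> carrier A" "meet A a b = zero A" "join A a b = one A"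
  shows "b = compl A a"
proof -
  let ?c = "compl A a"
  have c: "?c \<in> carrier A" using assms compl_closed by blast
  have "b = meet A b (join A a ?c)" using assms by (simp add: join_compl meet_one)
  also have "\<dots> = meet A b ?c"
    using assms c meet_join_distrib[of b a ?c]
    by (metis join_comm join_zero meet_closed meet_comm zero_closed)
  also have "\<dots> = meet A ?c (join A a b)"
    using assms c meet_join_distrib[of ?c a b]
    by (metis join_comm join_zero meet_closed meet_comm zero_closed meet_compl)
  finally show ?thesis using assms c by (simp add: meet_one)
qed

lemma compl_compl: "a \<in> carrier A \<Longrightarrow> compl A (compl A a) = a"
  by (metis compl_closed compl_unique join_comm join_compl meet_comm meet_compl)

lemma compl_one: "compl A (one A) = zero A"
  by (metis compl_unique join_zero meet_comm meet_one one_closed zero_closed)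

lemma compl_meet:
  assumes "a \<in> carrier A" "b \<in> carrier A"
  shows "compl A (meet A a b) = join A (compl A a) (compl A b)"
proof -
  let ?a = "compl A a" and ?b = "compl A b"
  note c = assms assms[THEN compl_closed]
  have 1: "meet A (meet A a b) ?a = zero A"
    using c by (metis meet_assoc meet_comm meet_compl meet_closed meet_zero)
  have 2: "meet A (meet A a b) ?b = zero A"
    using c by (metis meet_assoc meet_compl meet_zero)
  have 3: "join A (join A ?a ?b) a = one A"
    using c by (metis join_assoc join_comm join_compl join_one)
  have 4: "join A (join A ?a ?b) b = one A"
    using c by (metis join_assoc join_comm join_compl join_one)
  have "meet A (meet A a b) (join A ?a ?b) = zero A"
    using c 1 2 by (simp add: meet_join_distrib closed join_zero)
  moreover have "join A (join A ?a ?b) (meet A a b) = one A"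
    using c 3 4 by (simp add: join_meet_distrib closed meet_one)
  ultimately show ?thesis
    using c by (metis compl_unique join_closed join_comm meet_closed)
qed

lemma meet_eq_compl:
  "a \<in> carrier A \<Longrightarrow> b \<in> carrier A \<Longrightarrow>
    meet A a b = compl A (join A (compl A a) (compl A b))"
  by (metis compl_compl compl_meet meet_closed)

end


section \<open>Filters and ultrafilters\<close>

definition filter_in :: "'a bao \<Rightarrow> 'a set \<Rightarrow> bool" where
  "filter_in A F \<longleftrightarrow> F \<subseteq> carrier A \<and> one A \<in> F \<and> (\<forall>a\<in>F. \<forall>b\<in>F. meet A a b \<in> F) \<and>
     (\<forall>a\<in>F. \<forall>b\<in>carrier A. meet A a b = a \<longrightarrow> b \<in> F)"

text \<open>
  The inductive form of the generated filter makes compactness immediate, because a derivation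
  uses only finitely many members of \<open>S\<close>.
\<close>

inductive_set filter_gen :: "'a bao \<Rightarrow> 'a set \<Rightarrow> 'a set"
  for A :: "'a bao" and S :: "'a set" where
  gen_base: "a \<in> S \<Longrightarrow> a \<in> filter_gen A S"
| gen_one: "one A \<in> filter_gen A S"
| gen_meet: "\<lbrakk>a \<in> filter_gen A S; b \<in> filter_gen A S\<rbrakk> \<Longrightarrow> meet A a b \<in> filter_gen A S"
| gen_up: "\<lbrakk>a \<in> filter_gen A S; b \<in> carrier A; meet A a b = a\<rbrakk> \<Longrightarrow> b \<in> filter_gen A S"

lemma filter_gen_subset:
  assumes "filter_in A F" "S \<subseteq> F"
  shows "filter_gen A S \<subseteq> F"
proof
  fix a assume "a \<in> filter_gen A S"
  then show "a \<in> F"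
    by induction (use assms in \<open>auto simp: filter_in_def\<close>)
qed

lemma filter_gen_mono: "S \<subseteq> T \<Longrightarrow> filter_gen A S \<subseteq> filter_gen A T"
proof
  fix a assume "S \<subseteq> T" "a \<in> filter_gen A S"
  from this(2) show "a \<in> filter_gen A T"
    by induction (use \<open>S \<subseteq> T\<close> in \<open>auto intro: filter_gen.intros\<close>)
qed

lemma filter_gen_finitary:
  assumes "a \<in> filter_gen A S"
  shows "\<exists>T. finite T \<and> T \<subseteq> S \<and> a \<in> filter_gen A T"
  using assms
proof induction
  case (gen_base a)
  then show ?case by (intro exI[of _ "{a}"]) (auto intro: filter_gen.intros)
next
  case gen_one
  then show ?case by (intro exI[of _ "{}"]) (auto intro: filter_gen.intros)
next
  case (gen_meet a b)
  then obtain T T' where "finite T" "T \<subseteq> S" "a \<in> filter_gen A T"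
    "finite T'" "T' \<subseteq> S" "b \<in> filter_gen A T'" by blast
  then show ?case
    using filter_gen_mono[of T "T \<union> T'" A] filter_gen_mono[of T' "T \<union> T'" A]
    by (intro exI[of _ "T \<union> T'"]) (auto intro!: filter_gen.gen_meet)
next
  case (gen_up a b)
  then show ?case by (blast intro: filter_gen.gen_up)
qed

lemma ultrafilter_filter: "ultrafilter A U \<Longrightarrow> filter_in A U"
  by (auto simp: ultrafilter_def filter_in_def)

context BAO
begin

lemma filter_gen_filter: "S \<subseteq> carrier A \<Longrightarrow> filter_in A (filter_gen A S)"
proof -
  assume S: "S \<subseteq> carrier A"
  have "a \<in> carrier A" if "a \<in> filter_gen A S" for a
    using that by induction (use S in \<open>auto intro: closed\<close>)
  then show ?thesis
    by (auto simp: filter_in_def intro: filter_gen.intros)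
qed

lemma ultrafilter_compl_iff:
  assumes U: "ultrafilter A U" and a: "a \<in> carrier A"
  shows "compl A a \<in> U \<longleftrightarrow> a \<notin> U"
proof -
  have "meet A a (compl A a) \<notin> U"
    using U a by (simp add: ultrafilter_def meet_compl)
  then show ?thesis
    using U a unfolding ultrafilter_def by blast
qed

lemma ultrafilter_meet_iff:
  assumes U: "ultrafilter A U" and "a \<in> carrier A" "b \<in> carrier A"
  shows "meet A a b \<in> U \<longleftrightarrow> a \<in> U \<and> b \<in> U"
proof -
  have "meet A (meet A a b) a = meet A a b" "meet A (meet A a b) b = meet A a b"
    using assms by (metis meet_assoc meet_comm meet_closed meet_idem)+
  then show ?thesis using assms unfolding ultrafilter_def by blast
qed

lemma ultrafilter_join_iff:
  assumes U: "ultrafilter A U" and "a \<in> carrier A" "b \<in> carrier A"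
  shows "join A a b \<in> U \<longleftrightarrow> a \<in> U \<or> b \<in> U"
proof -
  have "join A a b = compl A (meet A (compl A a) (compl A b))"
    using assms by (simp add: compl_meet compl_compl closed)
  then show ?thesis
    using assms by (simp add: ultrafilter_compl_iff ultrafilter_meet_iff closed)
qed

lemma ultrafilter_inclusion_eq:
  assumes U: "ultrafilter A U" and V: "ultrafilter A V" and sub: "U \<subseteq> V"
  shows "U = V"
proof
  show "V \<subseteq> U"
  proof
    fix a assume a: "a \<in> V"
    then have c: "a \<in> carrier A" using V by (auto simp: ultrafilter_def)
    then have "compl A a \<notin> V" using a V ultrafilter_compl_iff by blast
    then show "a \<in> U" using sub U c ultrafilter_compl_iff by blast
  qed
qed (rule sub)

text \<open>
  By Zorn's lemma there is a maximal filter avoiding \<open>b\<close>. If it contained neither \<open>a\<close> nor its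
  complement, then adjoining either one would produce \<open>b\<close>; hence some member \<open>k\<close> of the filter
  satisfies both \<open>k \<and> a \<le> b\<close> and \<open>k \<and> \<not>a \<le> b\<close>, and so \<open>k \<le> b\<close>.
\<close>

lemma filter_ultrafilter_avoiding:
  assumes F: "filter_in A F" and b: "b \<in> carrier A" "b \<notin> F"
  shows "\<exists>U. ultrafilter A U \<and> F \<subseteq> U \<and> b \<notin> U"
proof -
  define \<A> where "\<A> = {G. filter_in A G \<and> F \<subseteq> G \<and> b \<notin> G}"
  have "\<exists>M\<in>\<A>. \<forall>X\<in>\<A>. M \<subseteq> X \<longrightarrow> X = M"
  proof (rule subset_Zorn_nonempty)
    show "\<A> \<noteq> {}" using assms by (auto simp: \<A>_def)
    fix \<C> assume ne: "\<C> \<noteq> {}" and ch: "subset.chain \<A> \<C>"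
    have mem: "filter_in A G \<and> F \<subseteq> G \<and> b \<notin> G" if "G \<in> \<C>" for G
      using that ch unfolding subset_chain_def \<A>_def by blast
    have "filter_in A (\<Union>\<C>)"
      unfolding filter_in_def
    proof (intro conjI ballI impI)
      show "\<Union>\<C> \<subseteq> carrier A" "one A \<in> \<Union>\<C>"
        using ne mem unfolding filter_in_def by blast+
    next
      fix x y assume "x \<in> \<Union>\<C>" "y \<in> \<Union>\<C>"
      then obtain G where "G \<in> \<C>" "x \<in> G" "y \<in> G"
        using ch unfolding subset_chain_def by blast
      then show "meet A x y \<in> \<Union>\<C>"
        using mem[of G] unfolding filter_in_def by blast
    next
      fix x y assume "x \<in> \<Union>\<C>" and y: "y \<in> carrier A" "meet A x y = x"
      then obtain G where "G \<in> \<C>" "x \<in> G" by blast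
      then show "y \<in> \<Union>\<C>"
        using y mem[of G] unfolding filter_in_def by blast
    qed
    then show "\<Union>\<C> \<in> \<A>"
      using ne mem unfolding \<A>_def by blast
  qed
  then obtain M where M\<A>: "M \<in> \<A>" "\<forall>X\<in>\<A>. M \<subseteq> X \<longrightarrow> X = M" ..
  then have M: "filter_in A M" "F \<subseteq> M" "b \<notin> M"
    by (simp_all add: \<A>_def)
  have max: "X = M" if "filter_in A X" "M \<subseteq> X" "b \<notin> X" for X
    using that M M\<A>(2) by (auto simp: \<A>_def)
  have Mc: "M \<subseteq> carrier A" and Mone: "one A \<in> M"
    and Mmeet: "\<And>x y. x \<in> M \<Longrightarrow> y \<in> M \<Longrightarrow> meet A x y \<in> M"
    and Mup: "\<And>x y. x \<in> M \<Longrightarrow> y \<in> carrier A \<Longrightarrow> meet A x y = x \<Longrightarrow> y \<in> M"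
    using M(1) unfolding filter_in_def by blast+
  have key: "\<exists>m\<in>M. meet A (meet A m a) b = meet A m a"
    if a: "a \<in> carrier A" "a \<notin> M" for a
  proof (rule ccontr)
    assume no: "\<not> ?thesis"
    \<comment> \<open>the filter generated by \<open>M\<close> and \<open>a\<close>\<close>
    define X where "X = {x \<in> carrier A. \<exists>m\<in>M. meet A (meet A m a) x = meet A m a}"
    have "filter_in A X"
      unfolding filter_in_def
    proof (intro conjI ballI impI)
      show "X \<subseteq> carrier A" by (auto simp: X_def)
      show "one A \<in> X" using Mone a by (auto simp: X_def intro!: closed bexI[of _ "one A"] meet_one)
    next
      fix x y assume "x \<in> X" "y \<in> X"
      then obtain m n where mn: "m \<in> M" "n \<in> M" "x \<in> carrier A" "y \<in> carrier A"
        "meet A (meet A m a) x = meet A m a" "meet A (meet A n a) y = meet A n a"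
        by (auto simp: X_def)
      have mc: "m \<in> carrier A" "n \<in> carrier A" using mn Mc by auto
      let ?k = "meet A (meet A m n) a"
      have k: "?k \<in> carrier A" using mc a by (simp add: closed)
      have "?k = meet A n (meet A m a)" "?k = meet A m (meet A n a)"
        using mc a by (metis meet_assoc meet_comm)+
      then have "meet A ?k x = ?k" "meet A ?k y = ?k"
        using mn mc a by (metis meet_assoc meet_closed)+
      then have "meet A ?k (meet A x y) = ?k"
        using mn k by (metis meet_assoc)
      then show "meet A x y \<in> X" using mn Mmeet by (auto simp: X_def closed)
    next
      fix x y assume x: "x \<in> X" "y \<in> carrier A" "meet A x y = x"
      then obtain m where m: "m \<in> M" "x \<in> carrier A" "meet A (meet A m a) x = meet A m a"
        by (auto simp: X_def)
      then have "meet A (meet A m a) y = meet A m a"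
        using x a Mc by (metis meet_assoc meet_closed subsetD)
      then show "y \<in> X" using x m by (auto simp: X_def)
    qed
    moreover have "M \<subseteq> X"
    proof
      fix m assume m: "m \<in> M"
      then have "meet A (meet A m a) m = meet A m a"
        using Mc a by (metis meet_assoc meet_comm meet_closed meet_idem subsetD)
      then show "m \<in> X" using m Mc by (auto simp: X_def)
    qed
    moreover have "b \<notin> X" using no by (auto simp: X_def)
    ultimately have "X = M" using max by blast
    moreover have "a \<in> X"
      using a Mone by (auto simp: X_def intro!: bexI[of _ "one A"])
        (metis meet_assoc meet_idem one_closed)
    ultimately show False using a by blast
  qed
  have "a \<in> M \<or> compl A a \<in> M" if a: "a \<in> carrier A" for a
  proof (rule ccontr)
    assume "\<not> ?thesis"
    then obtain m n where m: "m \<in> M" "meet A (meet A m a) b = meet A m a"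
      and n: "n \<in> M" "meet A (meet A n (compl A a)) b = meet A n (compl A a)"
      using key a compl_closed by metis
    have c: "m \<in> carrier A" "n \<in> carrier A" "compl A a \<in> carrier A"
      using m n Mc a by (auto intro: closed)
    let ?k = "meet A m n"
    have kc: "?k \<in> carrier A" using c by (simp add: closed)
    have "meet A ?k a = meet A n (meet A m a)"
         "meet A ?k (compl A a) = meet A m (meet A n (compl A a))"
      using c a by (metis meet_assoc meet_comm)+
    then have ka: "meet A (meet A ?k a) b = meet A ?k a"
        "meet A (meet A ?k (compl A a)) b = meet A ?k (compl A a)"
      using m(2) n(2) c a b by (metis meet_assoc meet_closed)+
    have k: "?k = join A (meet A ?k a) (meet A ?k (compl A a))"
      using kc a c by (metis join_compl meet_join_distrib meet_one)
    have "meet A b ?k = join A (meet A b (meet A ?k a)) (meet A b (meet A ?k (compl A a)))"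
      using b kc a c by (subst k) (simp add: meet_join_distrib closed)
    also have "\<dots> = ?k" using ka k b kc a c by (metis meet_closed meet_comm)
    finally have "meet A ?k b = ?k" using b kc by (metis meet_comm)
    then show False using M(3) Mup Mmeet m n b by blast
  qed
  moreover have "zero A \<notin> M" using M(3) Mup b by (metis meet_comm meet_zero zero_closed)
  ultimately have "ultrafilter A M"
    using Mc Mone Mmeet Mup unfolding ultrafilter_def by blast
  then show ?thesis using M by blast
qed

lemma ultrafilter_compactness:
  assumes "S \<subseteq> carrier A"
    and fin: "\<And>T. finite T \<Longrightarrow> T \<subseteq> S \<Longrightarrow> \<exists>U. ultrafilter A U \<and> T \<subseteq> U"
  shows "\<exists>U. ultrafilter A U \<and> S \<subseteq> U"
proof -
  have "zero A \<notin> filter_gen A S"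
  proof
    assume "zero A \<in> filter_gen A S"
    then obtain T where "finite T" "T \<subseteq> S" and z: "zero A \<in> filter_gen A T"
      using filter_gen_finitary by metis
    then obtain U where U: "ultrafilter A U" "T \<subseteq> U" using fin by blast
    then have "zero A \<in> U" using filter_gen_subset[OF ultrafilter_filter] z by blast
    then show False using U by (simp add: ultrafilter_def)
  qed
  then obtain U where "ultrafilter A U" "filter_gen A S \<subseteq> U"
    using filter_ultrafilter_avoiding filter_gen_filter assms(1) zero_closed by blast
  moreover have "S \<subseteq> filter_gen A S" by (auto intro: filter_gen.gen_base)
  ultimately show ?thesis by blast
qed

text \<open>
  In the Stone space, a set \<open>F\<close> of elements represents the closed set of ultrafilters containing
  it, and \<open>\<Union>K\<close> represents the intersection of the closed sets in \<open>K\<close>. By compactness, an empty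
  intersection is already caused by finitely many elements of \<open>\<Union>K\<close>, and a countable family
  has only countably many finite subfamilies \<open>K\<close>.
\<close>

lemma countable_separators:
  assumes "countable \<F>" "\<Union>\<F> \<subseteq> carrier A"
  shows "\<exists>X \<subseteq> carrier A. countable X \<and>
    (\<forall>K\<subseteq>\<F>. finite K \<longrightarrow> (\<nexists>U. ultrafilter A U \<and> \<Union>K \<subseteq> U) \<longrightarrow>
      (\<nexists>U. ultrafilter A U \<and> X \<inter> \<Union>K \<subseteq> U))"
proof -
  define \<K> where "\<K> = {K. finite K \<and> K \<subseteq> \<F> \<and> (\<nexists>U. ultrafilter A U \<and> \<Union>K \<subseteq> U)}"
  have ex: "\<exists>T. finite T \<and> T \<subseteq> \<Union>K \<and> (\<nexists>U. ultrafilter A U \<and> T \<subseteq> U)" if K: "K \<in> \<K>" for K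
  proof (rule ccontr)
    assume no: "\<not> ?thesis"
    have "\<exists>U. ultrafilter A U \<and> \<Union>K \<subseteq> U"
    proof (rule ultrafilter_compactness)
      have "K \<subseteq> \<F>" using K by (simp add: \<K>_def)
      then show "\<Union>K \<subseteq> carrier A" using assms(2) by blast
      show "\<exists>U. ultrafilter A U \<and> T \<subseteq> U" if "finite T" "T \<subseteq> \<Union>K" for T
        using no that by blast
    qed
    then show False using K unfolding \<K>_def by blast
  qed
  define T where "T K = (SOME T. finite T \<and> T \<subseteq> \<Union>K \<and> (\<nexists>U. ultrafilter A U \<and> T \<subseteq> U))" for K
  have T: "finite (T K)" "T K \<subseteq> \<Union>K" "\<nexists>U. ultrafilter A U \<and> T K \<subseteq> U" if "K \<in> \<K>" for K
    using someI_ex[OF ex[OF that]] by (simp_all add: T_def)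
  have "countable \<K>"
    by (rule countable_subset[OF _ countable_Collect_finite_subset[OF assms(1)]])
       (auto simp: \<K>_def)
  then have "countable (\<Union>(T ` \<K>))"
    using T(1) by (intro countable_UN) (auto intro: countable_finite)
  moreover have "\<Union>(T ` \<K>) \<subseteq> carrier A"
  proof (rule UN_least)
    fix K assume K: "K \<in> \<K>"
    then have "K \<subseteq> \<F>" by (simp add: \<K>_def)
    then show "T K \<subseteq> carrier A" using T(2)[OF K] assms(2) by blast
  qed
  moreover have "\<nexists>U. ultrafilter A U \<and> \<Union>(T ` \<K>) \<inter> \<Union>K \<subseteq> U"
    if "K \<subseteq> \<F>" "finite K" "\<nexists>U. ultrafilter A U \<and> \<Union>K \<subseteq> U" for K
  proof -
    have K: "K \<in> \<K>" using that by (simp add: \<K>_def)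
    then have "T K \<subseteq> \<Union>(T ` \<K>) \<inter> \<Union>K" using T(2) by blast
    then show ?thesis using T(3)[OF K] by (meson subset_trans)
  qed
  ultimately show ?thesis by (intro exI[of _ "\<Union>(T ` \<K>)"]) simp
qed

end


section \<open>Levels of a generated canonical subframe\<close>

definition box :: "'a bao \<Rightarrow> 'a \<Rightarrow> 'a" where
  "box A a = compl A (dia A (compl A a))"

text \<open>
  For an ultrafilter \<open>\<mu>\<close>, the \<open>i\<close>-th level consists of the elements that \<open>\<mu>\<close> forces to hold at
  all points reachable in \<open>i\<close> steps.
\<close>

primrec level :: "'a bao \<Rightarrow> 'a set \<Rightarrow> nat \<Rightarrow> 'a set" where
  "level A \<mu> 0 = \<mu>"
| "level A \<mu> (Suc i) = {a \<in> carrier A. box A a \<in> level A \<mu> i}"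

lemma in_varietyD:
  "in_variety L A \<Longrightarrow> \<phi> \<in> L \<Longrightarrow> range v \<subseteq> carrier A \<Longrightarrow> term_val A v \<phi> = one A"
  by (simp add: in_variety_def)

context BAO
begin

lemma box_closed: "a \<in> carrier A \<Longrightarrow> box A a \<in> carrier A"
  by (simp add: box_def closed)

lemma box_one: "box A (one A) = one A"
  by (metis box_def compl_compl compl_one dia_zero one_closed)

lemma box_meet:
  "a \<in> carrier A \<Longrightarrow> b \<in> carrier A \<Longrightarrow> box A (meet A a b) = meet A (box A a) (box A b)"
  by (simp add: box_def compl_meet dia_join closed meet_eq_compl compl_compl)

lemma box_mem_iff:
  "ultrafilter A \<nu> \<Longrightarrow> a \<in> carrier A \<Longrightarrow> box A a \<in> \<nu> \<longleftrightarrow> dia A (compl A a) \<notin> \<nu>"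
  by (simp add: box_def ultrafilter_compl_iff closed)

lemma canonical_rel_box_iff:
  assumes "ultrafilter A \<nu>" "ultrafilter A \<nu>'"
  shows "canonical_rel A \<nu> \<nu>' \<longleftrightarrow> {a \<in> carrier A. box A a \<in> \<nu>} \<subseteq> \<nu>'"
proof
  assume "canonical_rel A \<nu> \<nu>'"
  then show "{a \<in> carrier A. box A a \<in> \<nu>} \<subseteq> \<nu>'"
    using assms by (auto simp: canonical_rel_def box_mem_iff) (metis ultrafilter_compl_iff)
next
  assume *: "{a \<in> carrier A. box A a \<in> \<nu>} \<subseteq> \<nu>'"
  show "canonical_rel A \<nu> \<nu>'"
    unfolding canonical_rel_def
  proof
    fix a assume a: "a \<in> \<nu>'"
    then have c: "a \<in> carrier A" using assms by (auto simp: ultrafilter_def)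
    then have "box A (compl A a) \<notin> \<nu>"
      using * a ultrafilter_compl_iff[OF assms(2) c] compl_closed[OF c] by blast
    then show "dia A a \<in> \<nu>" using assms c by (simp add: box_mem_iff closed compl_compl)
  qed
qed

lemma level_filter: "filter_in A \<mu> \<Longrightarrow> filter_in A (level A \<mu> i)"
proof (induction i)
  case (Suc i)
  then have F: "filter_in A (level A \<mu> i)" by blast
  then have up: "box A b \<in> level A \<mu> i"
    if "box A a \<in> level A \<mu> i" "a \<in> carrier A" "b \<in> carrier A" "meet A a b = a" for a b
    using that box_meet[of a b] box_closed unfolding filter_in_def by metis
  then show ?case using F
    by (auto simp: filter_in_def closed box_one box_meet)
qed simp

text \<open>
  A point \<open>\<nu>\<close> over level \<open>i\<close> makes no more boxed elements true than the whole level does. For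
  the step from \<open>i\<close> to \<open>i + 1\<close>, let \<open>\<box>a\<close> hold at \<open>\<nu>\<close>. Then \<open>\<box>\<Diamond>\<not>a\<close> is not in level \<open>i\<close>, so it
  fails at some \<open>\<nu>'\<close> over level \<open>i\<close>; by the axiom \<open>\<Diamond>\<Diamond>\<not>a\<close> fails there too, that is, \<open>\<box>\<box>a\<close>
  holds at \<open>\<nu>'\<close>, and the induction hypothesis puts \<open>\<box>a\<close> into level \<open>i + 1\<close>.
\<close>

lemma level_successors:
  assumes ax: "\<And>\<nu> a. ultrafilter A \<nu> \<Longrightarrow> a \<in> carrier A \<Longrightarrow> dia A (dia A a) \<in> \<nu> \<Longrightarrow>
    box A (dia A a) \<in> \<nu>"
    and \<mu>: "ultrafilter A \<mu>" and \<nu>: "ultrafilter A \<nu>" "level A \<mu> i \<subseteq> \<nu>"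
  shows "{a \<in> carrier A. box A a \<in> \<nu>} = level A \<mu> (Suc i)"
proof
  show "level A \<mu> (Suc i) \<subseteq> {a \<in> carrier A. box A a \<in> \<nu>}" using \<nu> by auto
  show "{a \<in> carrier A. box A a \<in> \<nu>} \<subseteq> level A \<mu> (Suc i)"
    using \<nu>
  proof (induction i arbitrary: \<nu>)
    case 0
    then have "\<nu> = \<mu>" using \<mu> ultrafilter_inclusion_eq by auto
    then show ?case by auto
  next
    case (Suc i)
    show ?case
    proof clarify
      fix a assume a: "a \<in> carrier A" "box A a \<in> \<nu>"
      let ?d = "dia A (compl A a)"
      have d: "?d \<in> carrier A" "dia A ?d \<in> carrier A" using a by (simp_all add: closed)
      have "?d \<notin> \<nu>" using a Suc.prems box_mem_iff by blast
      then have "box A ?d \<notin> level A \<mu> i" using Suc.prems d by auto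
      then obtain \<nu>' where \<nu>': "ultrafilter A \<nu>'" "level A \<mu> i \<subseteq> \<nu>'" "box A ?d \<notin> \<nu>'"
        using filter_ultrafilter_avoiding[OF level_filter[OF ultrafilter_filter[OF \<mu>]]]
          box_closed[OF d(1)] by blast
      then have "dia A ?d \<notin> \<nu>'" using ax a by (meson compl_closed)
      then have "box A (box A a) \<in> \<nu>'"
        using \<nu>' a d by (simp add: box_mem_iff box_closed) (simp add: box_def compl_compl)
      then have "box A a \<in> level A \<mu> (Suc i)" using Suc.IH[OF \<nu>'(1,2)] a box_closed by blast
      then show "a \<in> level A \<mu> (Suc (Suc i))" using a by simp
    qed
  qed
qed

lemma in_variety_K5_2:
  assumes "in_variety L A" "K5_2 \<subseteq> L"
    and "ultrafilter A \<nu>" "a \<in> carrier A" "dia A (dia A a) \<in> \<nu>"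
  shows "box A (dia A a) \<in> \<nu>"
proof -
  have "Imp (Dia (Dia (Atom 0))) (Box (Dia (Atom 0))) \<in> L"
    by (rule subsetD[OF assms(2)]) (simp add: K5_2_def)
  then have "term_val A (\<lambda>_. a) (Imp (Dia (Dia (Atom 0))) (Box (Dia (Atom 0)))) = one A"
    using in_varietyD[OF assms(1), of _ "\<lambda>_. a"] assms(4) by simp
  then have "join A (compl A (dia A (dia A a))) (box A (dia A a)) = one A"
    by (simp add: Imp_def Box_def box_def)
  moreover have "one A \<in> \<nu>"
    using assms(3) unfolding ultrafilter_def by blast
  moreover have "dia A (dia A a) \<in> carrier A" "box A (dia A a) \<in> carrier A"
    using assms(4) by (simp_all add: dia_closed box_closed)
  ultimately show ?thesis
    using assms(5) ultrafilter_join_iff[OF assms(3)] ultrafilter_compl_iff[OF assms(3)]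
    by (metis compl_closed)
qed

end


section \<open>Embeddings\<close>

definition embedding :: "('b \<Rightarrow> 'a) \<Rightarrow> 'b bao \<Rightarrow> 'a bao \<Rightarrow> bool" where
  "embedding h B A \<longleftrightarrow> inj_on h (carrier B) \<and> h ` carrier B \<subseteq> carrier A \<and>
     zero B \<in> carrier B \<and> h (zero B) = zero A \<and>
     one B \<in> carrier B \<and> h (one B) = one A \<and>
     (\<forall>a\<in>carrier B. \<forall>b\<in>carrier B. join B a b \<in> carrier B \<and> h (join B a b) = join A (h a) (h b)) \<and>
     (\<forall>a\<in>carrier B. \<forall>b\<in>carrier B. meet B a b \<in> carrier B \<and> h (meet B a b) = meet A (h a) (h b)) \<and>
     (\<forall>a\<in>carrier B. compl B a \<in> carrier B \<and> h (compl B a) = compl A (h a)) \<and>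
     (\<forall>a\<in>carrier B. dia B a \<in> carrier B \<and> h (dia B a) = dia A (h a))"

text \<open>The trace on \<open>B\<close> of a set of elements of \<open>A\<close>, when \<open>B\<close> is viewed as a subalgebra of \<open>A\<close>.\<close>

definition pull :: "('b \<Rightarrow> 'a) \<Rightarrow> 'b bao \<Rightarrow> 'a set \<Rightarrow> 'b set" where
  "pull h B F = {b \<in> carrier B. h b \<in> F}"

text \<open>The axioms are equations, so injectivity of \<open>h\<close> reflects them from \<open>A\<close> to \<open>B\<close>.\<close>

lemma embedding_BAO:
  assumes A: "BAO A" and e: "embedding h B A"
  shows "BAO B"
proof -
  interpret BAO A by fact
  have inj: "a = b" if "h a = h b" "a \<in> carrier B" "b \<in> carrier B" for a b
    using that e by (auto simp: embedding_def inj_on_def)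
  have hc: "\<And>a. a \<in> carrier B \<Longrightarrow> h a \<in> carrier A"
    and cl: "zero B \<in> carrier B" "one B \<in> carrier B"
      "\<And>a b. a \<in> carrier B \<Longrightarrow> b \<in> carrier B \<Longrightarrow> join B a b \<in> carrier B"
      "\<And>a b. a \<in> carrier B \<Longrightarrow> b \<in> carrier B \<Longrightarrow> meet B a b \<in> carrier B"
      "\<And>a. a \<in> carrier B \<Longrightarrow> compl B a \<in> carrier B" "\<And>a. a \<in> carrier B \<Longrightarrow> dia B a \<in> carrier B"
    and hom: "h (zero B) = zero A" "h (one B) = one A"
      "\<And>a b. a \<in> carrier B \<Longrightarrow> b \<in> carrier B \<Longrightarrow> h (join B a b) = join A (h a) (h b)"
      "\<And>a b. a \<in> carrier B \<Longrightarrow> b \<in> carrier B \<Longrightarrow> h (meet B a b) = meet A (h a) (h b)"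
      "\<And>a. a \<in> carrier B \<Longrightarrow> h (compl B a) = compl A (h a)"
      "\<And>a. a \<in> carrier B \<Longrightarrow> h (dia B a) = dia A (h a)"
    using e by (auto simp: embedding_def)
  show ?thesis
    by (unfold_locales; (rule inj)?;
        (simp add: cl; fail
        | (simp add: cl hom,
           rule join_assoc meet_assoc join_comm meet_comm meet_join_distrib join_meet_distrib
             meet_one join_zero meet_compl join_compl dia_zero dia_join;
           simp add: hc)))
qed

lemma embedding_term_val:
  assumes e: "embedding h B A" and "range v \<subseteq> carrier B"
  shows "term_val B v \<phi> \<in> carrier B \<and> h (term_val B v \<phi>) = term_val A (h \<circ> v) \<phi>"
  by (induction \<phi>) (use assms in \<open>auto simp: embedding_def\<close>)

lemma embedding_in_variety:
  assumes A: "in_variety L A" and e: "embedding h B A"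
  shows "in_variety L B"
  unfolding in_variety_def
proof (intro conjI ballI allI impI)
  show "BAO B" using A e embedding_BAO by (auto simp: in_variety_def)
  fix \<phi> and v :: "nat \<Rightarrow> _" assume \<phi>: "\<phi> \<in> L" and v: "range v \<subseteq> carrier B"
  have "range (h \<circ> v) \<subseteq> carrier A" using v e by (auto simp: embedding_def)
  then have "h (term_val B v \<phi>) = h (one B)"
    using embedding_term_val[OF e v, of \<phi>] in_varietyD[OF A \<phi>] e
    by (simp add: embedding_def)
  then show "term_val B v \<phi> = one B"
    using embedding_term_val[OF e v, of \<phi>] e by (simp add: embedding_def inj_on_def)
qed

lemma pull_ultrafilter:
  assumes e: "embedding h B A" and U: "ultrafilter A U"
  shows "ultrafilter B (pull h B U)"
  unfolding ultrafilter_def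
proof (intro conjI ballI impI)
  fix a b assume "a \<in> pull h B U" "b \<in> carrier B" "meet B a b = a"
  then have "h a \<in> U" "h b \<in> carrier A" "meet A (h a) (h b) = h a" "b \<in> carrier B"
    using e unfolding pull_def embedding_def by force+
  then show "b \<in> pull h B U" using U by (auto simp: pull_def ultrafilter_def)
qed (use assms in \<open>auto simp: pull_def embedding_def ultrafilter_def\<close>)

lemma pull_level:
  assumes e: "embedding h B A"
  shows "level B (pull h B \<mu>) i = pull h B (level A \<mu> i)"
proof (induction i)
  case (Suc i)
  have "box B b \<in> carrier B \<and> h (box B b) = box A (h b)" "h b \<in> carrier A" if "b \<in> carrier B" for b
    using that e by (auto simp: embedding_def box_def)
  then show ?case using Suc by (auto simp: pull_def)
qed simp

text \<open>
  The upward closure of the image of \<open>p\<close> is a filter; it is proper because only the zero of \<open>B\<close>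
  is mapped to the zero of \<open>A\<close>.
\<close>

lemma ultrafilter_extends_along_embedding:
  assumes A: "BAO A" and e: "embedding h B A" and p: "ultrafilter B p"
  shows "\<exists>U. ultrafilter A U \<and> h ` p \<subseteq> U"
proof -
  interpret BAO A by fact
  define F where "F = {x \<in> carrier A. \<exists>b\<in>p. meet A (h b) x = h b}"
  have pc: "b \<in> carrier B" "h b \<in> carrier A" if "b \<in> p" for b
    using that p e by (auto simp: ultrafilter_def embedding_def)
  have "filter_in A F"
    unfolding filter_in_def
  proof (intro conjI ballI impI)
    show "F \<subseteq> carrier A" by (auto simp: F_def)
    show "one A \<in> F" using p pc by (auto simp: F_def closed meet_one ultrafilter_def)
  next
    fix x y assume "x \<in> F" "y \<in> F"
    then obtain b c where bc: "b \<in> p" "c \<in> p" "x \<in> carrier A" "y \<in> carrier A"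
      "meet A (h b) x = h b" "meet A (h c) y = h c" by (auto simp: F_def)
    let ?k = "meet A (h b) (h c)"
    note hc = pc(2)[OF bc(1)] pc(2)[OF bc(2)]
    have "h (meet B b c) = ?k"
      using e pc bc by (simp add: embedding_def)
    moreover have "meet B b c \<in> p"
      using bc p by (simp add: ultrafilter_def)
    moreover have "meet A ?k (meet A x y) = ?k"
    proof -
      have "meet A ?k x = meet A (h c) (meet A (h b) x)" "meet A ?k y = meet A (h b) (meet A (h c) y)"
        using hc bc(3,4) by (metis meet_assoc meet_comm)+
      then have "meet A ?k x = ?k" "meet A ?k y = ?k"
        using hc bc(5,6) by (metis meet_comm)+
      then show ?thesis using hc bc(3,4) by (metis meet_assoc meet_closed)
    qed
    ultimately show "meet A x y \<in> F"
      using bc(3,4) unfolding F_def by (metis (mono_tags, lifting) mem_Collect_eq meet_closed)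
  next
    fix x y assume x: "x \<in> F" "y \<in> carrier A" "meet A x y = x"
    then obtain b where b: "b \<in> p" "x \<in> carrier A" "meet A (h b) x = h b"
      by (auto simp: F_def)
    then have "meet A (h b) y = h b"
      using x(2,3) pc(2)[OF b(1)] by (metis meet_assoc)
    then show "y \<in> F" using x(2) b(1) by (auto simp: F_def)
  qed
  moreover have "zero A \<notin> F"
  proof
    assume "zero A \<in> F"
    then obtain b where b: "b \<in> p" "zero A = h b"
      using pc by (auto simp: F_def meet_zero)
    then have "b = zero B" using e pc by (auto simp: embedding_def inj_on_def)
    then show False using b p by (auto simp: ultrafilter_def)
  qed
  ultimately obtain U where "ultrafilter A U" "F \<subseteq> U"
    using filter_ultrafilter_avoiding zero_closed by blast
  moreover have "h ` p \<subseteq> F"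
    using pc(2) meet_idem by (fastforce simp: F_def)
  ultimately show ?thesis by blast
qed

text \<open>
  Every generated element is the value of a formula under one fixed enumeration of the generators;
  adding the unit to the generators makes the enumeration possible when there are none.
\<close>

lemma (in BAO) generated_countable:
  assumes X: "X \<subseteq> carrier A" "countable X"
  shows "countable (generated A X)"
proof -
  define Y where "Y = insert (one A) X"
  define v where "v = from_nat_into Y"
  have v: "range v = Y" using X unfolding v_def Y_def by (intro range_from_nat_into) auto
  have "a \<in> carrier A \<and> a \<in> range (term_val A v)" if "a \<in> generated A X" for a
    using that
  proof induction
    case (1 x)
    then obtain n where "x = v n" using v unfolding Y_def by blast
    then show ?case using X 1 by (auto intro: range_eqI[of _ _ "Atom n"])
  next
    case 2
    then show ?case by (auto simp: closed compl_one intro: range_eqI[of _ _ "Neg Top"])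
  next
    case 3
    then show ?case by (auto simp: closed intro: range_eqI[of _ _ Top])
  next
    case (4 a b)
    then obtain \<phi> \<psi> where "a = term_val A v \<phi>" "b = term_val A v \<psi>" by blast
    then show ?case using 4 by (auto simp: closed intro: range_eqI[of _ _ "Or \<phi> \<psi>"])
  next
    case (5 a b)
    then obtain \<phi> \<psi> where "a = term_val A v \<phi>" "b = term_val A v \<psi>" by blast
    then show ?case using 5
      by (auto simp: closed And_def meet_eq_compl intro: range_eqI[of _ _ "And \<phi> \<psi>"])
  next
    case (6 a)
    then obtain \<phi> where "a = term_val A v \<phi>" by blast
    then show ?case using 6 by (auto simp: closed intro: range_eqI[of _ _ "Neg \<phi>"])
  next
    case (7 a)
    then obtain \<phi> where "a = term_val A v \<phi>" by blast
    then show ?case using 7 by (auto simp: closed intro: range_eqI[of _ _ "Dia \<phi>"])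
  qed
  then have "generated A X \<subseteq> range (term_val A v)" by blast
  then show ?thesis by (rule countable_subset) simp
qed

text \<open>
  The countable subalgebra generated by \<open>X\<close> is copied into the given infinite type, where
  \<open>\<omega>\<close>-canonicity is assumed.
\<close>

lemma (in BAO) countable_algebra_copy:
  assumes X: "X \<subseteq> carrier A" "countable X" and inf: "infinite (UNIV :: 'b set)"
  shows "\<exists>(B :: 'b bao) h Y. embedding h B A \<and> X \<subseteq> h ` carrier B \<and>
    Y \<subseteq> carrier B \<and> countable Y \<and> generated B Y = carrier B"
proof -
  define C where "C = generated A X"
  have C: "C \<subseteq> carrier A"
  proof
    fix a assume "a \<in> C" then show "a \<in> carrier A"
      unfolding C_def by induction (use X in \<open>auto intro: closed\<close>)
  qed
  obtain e :: "nat \<Rightarrow> 'b" where e: "inj e" using inf infinite_countable_subset by blast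
  define f where "f = e \<circ> to_nat_on C"
  have f: "inj_on f C"
    unfolding f_def using generated_countable[OF X] e
    by (intro comp_inj_on) (auto simp: C_def intro: inj_on_subset)
  define h where "h = inv_into C f"
  have hf: "h (f c) = c" if "c \<in> C" for c
    using f that by (simp add: h_def)
  define B :: "'b bao" where "B = \<lparr>carrier = f ` C, zero = f (zero A), one = f (one A),
    join = (\<lambda>x y. f (join A (h x) (h y))), meet = (\<lambda>x y. f (meet A (h x) (h y))),
    compl = (\<lambda>x. f (compl A (h x))), dia = (\<lambda>x. f (dia A (h x)))\<rparr>"
  have gen: "x \<in> X \<Longrightarrow> x \<in> C" "zero A \<in> C" "one A \<in> C"
    "a \<in> C \<Longrightarrow> b \<in> C \<Longrightarrow> join A a b \<in> C" "a \<in> C \<Longrightarrow> b \<in> C \<Longrightarrow> meet A a b \<in> C"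
    "a \<in> C \<Longrightarrow> compl A a \<in> C" "a \<in> C \<Longrightarrow> dia A a \<in> C" for x a b
    unfolding C_def by (auto intro: generated.intros)
  have emb: "embedding h B A"
    unfolding embedding_def B_def using C by (auto simp: hf gen inj_on_def)
  have "f a \<in> generated B (f ` X)" if "a \<in> C" for a
    using that[unfolded C_def]
  proof induction
    case (1 x) then show ?case by (auto intro: generated.intros)
  next
    case 2
    then show ?case using generated.intros(2)[of B "f ` X"] by (simp add: B_def)
  next
    case 3
    then show ?case using generated.intros(3)[of B "f ` X"] by (simp add: B_def)
  next
    case (4 a b)
    then show ?case using generated.intros(4)[of "f a" B "f ` X" "f b"]
      by (simp add: B_def hf C_def)
  next
    case (5 a b)
    then show ?case using generated.intros(5)[of "f a" B "f ` X" "f b"]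
      by (simp add: B_def hf C_def)
  next
    case (6 a)
    then show ?case using generated.intros(6)[of "f a" B "f ` X"] by (simp add: B_def hf C_def)
  next
    case (7 a)
    then show ?case using generated.intros(7)[of "f a" B "f ` X"] by (simp add: B_def hf C_def)
  qed
  moreover have "b \<in> f ` C" if "b \<in> generated B (f ` X)" for b
    using that by induction (auto simp: B_def hf gen)
  ultimately have "generated B (f ` X) = carrier B" by (auto simp: B_def)
  moreover have "f ` X \<subseteq> carrier B" "countable (f ` X)" "X \<subseteq> h ` carrier B"
    using X gen(1) hf by (auto simp: B_def image_iff)
  ultimately show ?thesis using emb by blast
qed



section \<open>Complex algebras\<close>

lemma complex_algebra_BAO: "BAO (complex_algebra W R)"
  by unfold_locales (auto simp: complex_algebra_def)

lemma complex_algebra_dia: "dia (complex_algebra W R) X = {\<mu> \<in> W. \<exists>\<nu>\<in>X. R \<mu> \<nu>}"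
  by (simp add: complex_algebra_def)

lemma complex_algebra_term_val_subset:
  "range v \<subseteq> Pow W \<Longrightarrow> term_val (complex_algebra W R) v \<phi> \<subseteq> W"
  by (induction \<phi>) (auto simp: complex_algebra_def)


section \<open>Reduction to countably generated algebras\<close>

text \<open>
  In both frames the successors of a point depend only on the level at which it is viewed, so the
  induction on formulas needs only to know that \<open>g\<close> maps levels into levels and meets every
  truth set that is inhabited in a level. As levels may overlap, the claim is proved for each level
  that contains the point.
\<close>

lemma truth_transfer:
  assumes T: "\<And>i. T i \<subseteq> W'" and S: "\<And>i. S i \<subseteq> W"
    and succT: "\<And>i p q. p \<in> T i \<Longrightarrow> q \<in> W' \<Longrightarrow> R' p q \<longleftrightarrow> q \<in> T (Suc i)"
    and succS: "\<And>i \<mu> \<nu>. \<mu> \<in> S i \<Longrightarrow> \<nu> \<in> W \<Longrightarrow> R \<mu> \<nu> \<longleftrightarrow> \<nu> \<in> S (Suc i)"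
    and v: "range v \<subseteq> Pow W"
    and g: "\<And>i p. p \<in> T i \<Longrightarrow> g p \<in> S i"
    and reps: "\<And>i \<psi>. S i \<inter> term_val (complex_algebra W R) v \<psi> \<noteq> {} \<Longrightarrow>
      g ` T i \<inter> term_val (complex_algebra W R) v \<psi> \<noteq> {}"
    and p: "p \<in> T i"
  shows "p \<in> term_val (complex_algebra W' R') (\<lambda>n. {p \<in> W'. g p \<in> v n}) \<phi> \<longleftrightarrow>
     g p \<in> term_val (complex_algebra W R) v \<phi>"
  using p
proof (induction \<phi> arbitrary: p i)
  case (Atom n)
  then show ?case using T by auto
next
  case Top
  then have "p \<in> W'" "g p \<in> W" using T S g by blast+
  then show ?case by (simp add: complex_algebra_def)
next
  case (Neg \<phi>)
  then have "p \<in> W'" "g p \<in> W" using T S g by blast+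
  then show ?case using Neg by (simp add: complex_algebra_def)
next
  case (Or \<phi> \<psi>)
  then show ?case by (auto simp: complex_algebra_def)
next
  case (Dia \<phi>)
  let ?M = "term_val (complex_algebra W R) v \<phi>"
  let ?N = "term_val (complex_algebra W' R') (\<lambda>n. {p \<in> W'. g p \<in> v n}) \<phi>"
  have MN: "?M \<subseteq> W" "?N \<subseteq> W'"
    using v by (auto intro!: complex_algebra_term_val_subset simp del: subset_iff)
  have "p \<in> term_val (complex_algebra W' R') (\<lambda>n. {p \<in> W'. g p \<in> v n}) (Dia \<phi>) \<longleftrightarrow>
      (\<exists>q\<in>T (Suc i). q \<in> ?N)"
    using T MN(2) succT[OF Dia.prems] Dia.prems
    unfolding term_val.simps complex_algebra_dia by blast
  also have "\<dots> \<longleftrightarrow> (\<exists>q\<in>T (Suc i). g q \<in> ?M)"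
    using Dia.IH by blast
  also have "\<dots> \<longleftrightarrow> (\<exists>\<nu>\<in>S (Suc i). \<nu> \<in> ?M)"
    using g reps[of "Suc i" \<phi>] by blast
  also have "\<dots> \<longleftrightarrow> g p \<in> term_val (complex_algebra W R) v (Dia \<phi>)"
    using S MN(1) succS[OF g[OF Dia.prems]] g[OF Dia.prems]
    unfolding term_val.simps complex_algebra_dia by blast
  finally show ?case .
qed

text \<open>
  The algebra \<open>B\<close> depends on \<open>\<mu>\<close> and \<open>v\<close>, through the levels over \<open>\<mu>\<close> and the representatives of
  the formulas satisfied there, but it serves all formulas at once.
\<close>

lemma countably_generated_point_same_theory:
  assumes A: "in_variety L A" and L: "K5_2 \<subseteq> L"
    and v: "range v \<subseteq> Pow (canonical_points A)" and \<mu>: "\<mu> \<in> canonical_points A"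
    and inf: "infinite (UNIV :: 'b set)"
  obtains B :: "'b bao" and Y w p where "in_variety L B"
    and "Y \<subseteq> carrier B" "countable Y" "generated B Y = carrier B"
    and "range w \<subseteq> Pow (canonical_points B)" "p \<in> canonical_points B"
    and "\<And>\<phi>. p \<in> term_val (canonical_extension B) w \<phi> \<longleftrightarrow>
      \<mu> \<in> term_val (canonical_extension A) v \<phi>"
proof -
  interpret A: BAO A using A by (simp add: in_variety_def)
  have \<mu>u: "ultrafilter A \<mu>" using \<mu> by (simp add: canonical_points_def)
  define S where "S i = {\<nu>. ultrafilter A \<nu> \<and> level A \<mu> i \<subseteq> \<nu>}" for i
  define sat where "sat \<psi> = term_val (canonical_extension A) v \<psi>" for \<psi>
  \<comment> \<open>the value \<open>\<mu>\<close> at unsatisfiable pairs only keeps every \<open>rep i \<psi>\<close> an ultrafilter\<close>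
  define rep where "rep i \<psi> = (if S i \<inter> sat \<psi> = {} then \<mu> else SOME \<nu>. \<nu> \<in> S i \<inter> sat \<psi>)" for i \<psi>
  have rep: "rep i \<psi> \<in> S i \<inter> sat \<psi>" if "S i \<inter> sat \<psi> \<noteq> {}" for i \<psi>
    using that some_in_eq[of "S i \<inter> sat \<psi>"] by (simp add: rep_def)
  have rep_ultra: "ultrafilter A (rep i \<psi>)" for i \<psi>
    using rep[of i \<psi>] \<mu>u by (cases "S i \<inter> sat \<psi> = {}") (auto simp: rep_def S_def)
  define \<F> where "\<F> = range (level A \<mu>) \<union> range (case_prod rep)"
  have "countable \<F>" by (simp add: \<F>_def)
  moreover have \<F>: "\<Union>\<F> \<subseteq> carrier A"
  proof (rule Union_least)
    fix F assume "F \<in> \<F>"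
    then have "filter_in A F"
      using A.level_filter[OF ultrafilter_filter[OF \<mu>u]] ultrafilter_filter[OF rep_ultra]
      by (auto simp: \<F>_def)
    then show "F \<subseteq> carrier A" by (simp add: filter_in_def)
  qed
  ultimately obtain X where X: "X \<subseteq> carrier A" "countable X"
    and sep: "\<forall>K\<subseteq>\<F>. finite K \<longrightarrow> (\<nexists>U. ultrafilter A U \<and> \<Union>K \<subseteq> U) \<longrightarrow>
      (\<nexists>U. ultrafilter A U \<and> X \<inter> \<Union>K \<subseteq> U)"
    using A.countable_separators[of \<F>] by blast
  obtain B :: "'b bao" and h Y where e: "embedding h B A" and Xh: "X \<subseteq> h ` carrier B"
    and Y: "Y \<subseteq> carrier B" "countable Y" "generated B Y = carrier B"
    using A.countable_algebra_copy[OF X inf] by blast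
  have B: "in_variety L B" using embedding_in_variety[OF A e] .
  interpret B: BAO B using B by (simp add: in_variety_def)
  \<comment> \<open>the members of the family that have \<open>p\<close> as a trace have a common point: an extension \<open>V\<close>
    of \<open>p\<close> to \<open>A\<close> contains all separators taken from these members\<close>
  have "\<exists>U. ultrafilter A U \<and> \<Union>{F \<in> \<F>. pull h B F \<subseteq> p} \<subseteq> U" if p: "ultrafilter B p" for p
  proof (rule A.ultrafilter_compactness)
    show "\<Union>{F \<in> \<F>. pull h B F \<subseteq> p} \<subseteq> carrier A" using \<F> by blast
    fix T assume "finite T" "T \<subseteq> \<Union>{F \<in> \<F>. pull h B F \<subseteq> p}"
    then obtain K where K: "finite K" "K \<subseteq> {F \<in> \<F>. pull h B F \<subseteq> p}" "T \<subseteq> \<Union>K"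
      by (rule finite_subset_Union)
    obtain V where V: "ultrafilter A V" "h ` p \<subseteq> V"
      using ultrafilter_extends_along_embedding[OF A.BAO_axioms e p] by blast
    have "X \<inter> \<Union>K \<subseteq> h ` p" using K(2) Xh by (fastforce simp: pull_def)
    then have "X \<inter> \<Union>K \<subseteq> V" using V(2) by (rule subset_trans)
    moreover have "K \<subseteq> \<F>" using K(2) by auto
    ultimately have "\<exists>U. ultrafilter A U \<and> \<Union>K \<subseteq> U" using sep K(1) V(1) by meson
    then show "\<exists>U. ultrafilter A U \<and> T \<subseteq> U" using K(3) by blast
  qed
  then have "\<forall>p. \<exists>U. ultrafilter B p \<longrightarrow>
      ultrafilter A U \<and> \<Union>{F \<in> \<F>. pull h B F \<subseteq> p} \<subseteq> U"
    by blast
  then obtain g where g: "\<forall>p. ultrafilter B p \<longrightarrow>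
      ultrafilter A (g p) \<and> \<Union>{F \<in> \<F>. pull h B F \<subseteq> p} \<subseteq> g p"
    unfolding choice_iff ..
  have g_ultra: "ultrafilter A (g p)" if "ultrafilter B p" for p
    using g that by blast
  have g_sup: "F \<subseteq> g p" if "ultrafilter B p" "F \<in> \<F>" "pull h B F \<subseteq> p" for p F
    using g that by blast
  define T where "T i = {p. ultrafilter B p \<and> level B (pull h B \<mu>) i \<subseteq> p}" for i
  have pull_T: "pull h B \<nu> \<in> T i" if "\<nu> \<in> S i" for \<nu> i
    using that pull_ultrafilter[OF e, of \<nu>] pull_level[OF e, of \<mu> i]
    by (auto simp: T_def S_def pull_def)
  have g_T: "g p \<in> S i" if "p \<in> T i" for p i
    using that g_ultra g_sup[of p "level A \<mu> i"]
    by (auto simp: T_def S_def pull_level[OF e] \<F>_def)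
  \<comment> \<open>the value extends the ultrafilter \<open>F\<close>, hence equals it\<close>
  have g_pull: "g (pull h B F) = F" if "F \<in> \<F>" "ultrafilter A F" for F
    using that g_ultra[of "pull h B F"] g_sup[of "pull h B F" F] pull_ultrafilter[OF e]
      A.ultrafilter_inclusion_eq by blast
  define w where "w n = {p \<in> canonical_points B. g p \<in> v n}" for n
  have transfer: "p \<in> term_val (canonical_extension B) w \<phi> \<longleftrightarrow>
      g p \<in> term_val (canonical_extension A) v \<phi>" if "p \<in> T i" for p i \<phi>
    unfolding canonical_extension_def w_def
  proof (rule truth_transfer[where S = S and T = T and i = i])
    show "T i \<subseteq> canonical_points B" "S i \<subseteq> canonical_points A" for i
      by (auto simp: T_def S_def canonical_points_def)
    show "canonical_rel B p q \<longleftrightarrow> q \<in> T (Suc i)"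
      if "p \<in> T i" "q \<in> canonical_points B" for i p q
      using that B.canonical_rel_box_iff[of p q]
        B.level_successors[OF B.in_variety_K5_2[OF B L] pull_ultrafilter[OF e \<mu>u], of p i]
      by (auto simp: T_def canonical_points_def)
    show "canonical_rel A \<nu> \<nu>' \<longleftrightarrow> \<nu>' \<in> S (Suc i)"
      if "\<nu> \<in> S i" "\<nu>' \<in> canonical_points A" for i \<nu> \<nu>'
      using that A.canonical_rel_box_iff[of \<nu> \<nu>']
        A.level_successors[OF A.in_variety_K5_2[OF A L] \<mu>u, of \<nu> i]
      by (auto simp: S_def canonical_points_def)
    show "g ` T i \<inter> term_val (complex_algebra (canonical_points A) (canonical_rel A)) v \<psi> \<noteq> {}"
      if "S i \<inter> term_val (complex_algebra (canonical_points A) (canonical_rel A)) v \<psi> \<noteq> {}" for i \<psi>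
    proof -
      have r: "rep i \<psi> \<in> S i" "rep i \<psi> \<in> sat \<psi>"
        using rep[of i \<psi>] that by (auto simp: sat_def canonical_extension_def)
      have "rep i \<psi> \<in> \<F>" by (auto simp: \<F>_def)
      then have "rep i \<psi> \<in> g ` T i"
        using pull_T[OF r(1)] g_pull[OF _ rep_ultra] by (metis imageI)
      then show ?thesis using r(2) by (auto simp: sat_def canonical_extension_def)
    qed
  qed (use v g_T that in auto)
  have "\<mu> \<in> \<F>" by (auto simp: \<F>_def intro: range_eqI[of _ _ 0])
  moreover have "pull h B \<mu> \<in> T 0" using pull_T[of \<mu> 0] \<mu>u by (simp add: S_def)
  ultimately have "pull h B \<mu> \<in> term_val (canonical_extension B) w \<phi> \<longleftrightarrow>
      \<mu> \<in> term_val (canonical_extension A) v \<phi>" for \<phi>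
    using transfer g_pull \<mu>u by metis
  moreover have "range w \<subseteq> Pow (canonical_points B)" "pull h B \<mu> \<in> canonical_points B"
    using pull_ultrafilter[OF e \<mu>u] by (auto simp: w_def canonical_points_def)
  ultimately show thesis using that B Y by metis
qed

theorem theorem4p3:
  fixes L :: "fm set"
  assumes "normal_logic L"
    and "K5_2 \<subseteq> L"
    and "infinite (UNIV :: 'b set)"
    and "kappa_canonical TYPE('b) natLeq L"
  shows "totally_canonical TYPE('a) L"
  unfolding totally_canonical_def
proof (intro allI impI)
  fix A :: "'a bao" assume A: "in_variety L A"
  show "in_variety L (canonical_extension A)"
    unfolding in_variety_def
  proof (intro conjI ballI allI impI)
    show "BAO (canonical_extension A)"
      by (simp add: canonical_extension_def complex_algebra_BAO)
    fix \<phi> and v :: "nat \<Rightarrow> 'a set set"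
    assume \<phi>: "\<phi> \<in> L" and "range v \<subseteq> carrier (canonical_extension A)"
    then have v: "range v \<subseteq> Pow (canonical_points A)"
      by (simp add: canonical_extension_def complex_algebra_def)
    have "\<mu> \<in> term_val (canonical_extension A) v \<phi>" if \<mu>: "\<mu> \<in> canonical_points A" for \<mu>
    proof -
      obtain B :: "'b bao" and Y w p where B: "in_variety L B"
        and Y: "Y \<subseteq> carrier B" "countable Y" "generated B Y = carrier B"
        and w: "range w \<subseteq> Pow (canonical_points B)" "p \<in> canonical_points B"
        and eq: "\<And>\<phi>. p \<in> term_val (canonical_extension B) w \<phi> \<longleftrightarrow>
          \<mu> \<in> term_val (canonical_extension A) v \<phi>"
        by (rule countably_generated_point_same_theory[OF A assms(2) v \<mu> assms(3)]) (rule that)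
      have "in_variety L (canonical_extension B)"
        using assms(4) B Y countable_card_le_natLeq unfolding kappa_canonical_def by metis
      then have "term_val (canonical_extension B) w \<phi> = canonical_points B"
        using in_varietyD[OF _ \<phi>, of "canonical_extension B" w] w(1)
        by (simp add: canonical_extension_def complex_algebra_def)
      then show ?thesis using eq w(2) by blast
    qed
    moreover have "term_val (canonical_extension A) v \<phi> \<subseteq> canonical_points A"
      unfolding canonical_extension_def using v by (rule complex_algebra_term_val_subset)
    ultimately show "term_val (canonical_extension A) v \<phi> = one (canonical_extension A)"
      by (auto simp: canonical_extension_def complex_algebra_def)
  qed
qed

end
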